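(* Let $F$ be a field of characteristic $0$ or an algebraically closed field of characteristic $p>2$. A finite dimensional Novikov algebra over the field $F$ is left quasiregular if and only if it is solvable.
   Context: Algebras over a field are not assumed associative or unital. For elements $x,y,z$ of an algebra, the associator is $(x,y,z)=(xy)z-x(yz)$. An algebra $A$ over a field is a Novikov algebra if $(x,y,z)=(y,x,z)$ and $(xy)z=(xz)y$ for all $x,y,z\in A$. An element $x\in A$ is left quasiregular if there exists $y\in A$ such that $x+y=yx$. An algebra is left quasiregular if all its elements are left quasiregular. An algebra $A$ is solvable if $A^{(n)}=0$ for some $n$, where $A^{(0)}=A$ and $A^{(k+1)}=A^{(k)}A^{(k)}$ (the linear span of all products of two elements of $A^{(k)}$). *)

theory Defs
  imports "HOL-Computational_Algebra.Polynomial"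
begin

(* The library's class alg_closed_field is a sort constraint and cannot occur inside a
   disjunction, so algebraic closedness is stated as a predicate on a field type. *)
definition alg_closed :: "'f::field itself \<Rightarrow> bool" where
  "alg_closed _ \<longleftrightarrow> (\<forall>p :: 'f poly. degree p > 0 \<longrightarrow> (\<exists>x. poly p x = 0))"

locale nonassoc_algebra = vector_space scale
  for scale :: "'f::field \<Rightarrow> 'a::ab_group_add \<Rightarrow> 'a" (infixr \<open>*s\<close> 75) +
  fixes mult :: "'a \<Rightarrow> 'a \<Rightarrow> 'a" (infixl \<open>\<odot>\<close> 70)
  assumes mult_add_left: "(x + y) \<odot> z = x \<odot> z + y \<odot> z"
    and mult_add_right: "x \<odot> (y + z) = x \<odot> y + x \<odot> z"
    and mult_scale_left: "(c *s x) \<odot> y = c *s (x \<odot> y)"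
    and mult_scale_right: "x \<odot> (c *s y) = c *s (x \<odot> y)"
begin

definition associator :: "'a \<Rightarrow> 'a \<Rightarrow> 'a \<Rightarrow> 'a" where
  "associator x y z = (x \<odot> y) \<odot> z - x \<odot> (y \<odot> z)"

definition left_quasiregular_elem :: "'a \<Rightarrow> bool" where
  "left_quasiregular_elem x \<longleftrightarrow> (\<exists>y. x + y = y \<odot> x)"

definition left_quasiregular :: bool where
  "left_quasiregular \<longleftrightarrow> (\<forall>x. left_quasiregular_elem x)"

primrec derived :: "nat \<Rightarrow> 'a set" where
  "derived 0 = UNIV"
| "derived (Suc k) = span {x \<odot> y | x y. x \<in> derived k \<and> y \<in> derived k}"

definition solvable :: bool where
  "solvable \<longleftrightarrow> (\<exists>n. derived n = {0})"

end

locale novikov_algebra = nonassoc_algebra scale mult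
  for scale :: "'f::field \<Rightarrow> 'a::ab_group_add \<Rightarrow> 'a" (infixr \<open>*s\<close> 75)
    and mult :: "'a \<Rightarrow> 'a \<Rightarrow> 'a" (infixl \<open>\<odot>\<close> 70) +
  assumes left_symmetric: "associator x y z = associator y x z"
    and right_commutative: "(x \<odot> y) \<odot> z = (x \<odot> z) \<odot> y"

end

theory Submission
  imports Defs
begin

text \<open>
  Write \<open>R\<^sub>x\<close> and \<open>L\<^sub>y\<close> for right and left multiplication. The \<open>R\<^sub>x\<close> generate a commutative
  algebra \<open>P\<close> of operators, and left symmetry says \<open>[R\<^sub>z, L\<^sub>y] = R\<^sub>z R\<^sub>y - R\<^sub>y\<^sub>z\<close>, so that every
  \<open>[\<cdot>, L\<^sub>y]\<close> is a derivation of \<open>P\<close>. The element \<open>x\<close> is left quasiregular iff it lies in the range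
  of \<open>R\<^sub>x - 1\<close>.

  Solvable implies quasiregular: the Fitting components \<open>K\<close> (null) and \<open>I\<close> of \<open>T = R\<^sub>x - 1\<close> are
  two-sided ideals, because \<open>T\<^sup>n\<^sup>+\<^sup>1 L\<^sub>y - L\<^sub>y T\<^sup>n\<^sup>+\<^sup>1 \<in> T\<^sup>n P\<close>; hence \<open>K I = 0\<close>. Writing \<open>x = u + i\<close>
  with \<open>u \<in> K\<close>, \<open>i \<in> I\<close>, the operator \<open>R\<^sub>u = R\<^sub>x\<close> is invertible on \<open>K\<close>, so \<open>K = K K\<close> and solvability
  gives \<open>K = 0\<close>; thus \<open>x = i\<close> is in the range of \<open>T\<close>.

  Quasiregular implies solvable: for an ideal \<open>B \<noteq> 0\<close> it suffices that a maximal proper right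
  subideal \<open>M\<close> contains \<open>B B\<close>. The operators of \<open>P\<close> mapping \<open>B\<close> into \<open>M\<close> form a prime ideal \<open>J\<close>.
  Over an algebraically closed field \<open>R\<^sub>z - \<mu>(z) \<in> J\<close> for a linear form \<open>\<mu>\<close>; quasiregularity puts
  all \<open>z \<in> B\<close> with \<open>\<mu>(z) = 1\<close> into \<open>M\<close>, and these would span \<open>B\<close> if \<open>\<mu> \<noteq> 0\<close> on \<open>B\<close>. In characteristic \<open>0\<close>
  the derivations map \<open>P\<close> into \<open>J\<close>, since they vanish on a finite separable extension; hence
  \<open>z \<mapsto> R\<^sub>z\<close> is multiplicative modulo \<open>J\<close>, and if \<open>B B\<close> is not inside \<open>M\<close> then some \<open>e \<in> B\<close> acts as
  the identity modulo \<open>M\<close>, which is incompatible with \<open>e + y = y e\<close>.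
\<close>

section \<open>Bilinearity and the operators generated by right multiplications\<close>

locale fd_novikov_algebra =
  novikov_algebra scale mult + finite_dimensional_vector_space scale Basis
  for scale :: "'f::field \<Rightarrow> 'a::ab_group_add \<Rightarrow> 'a" (infixr \<open>*s\<close> 75)
    and mult :: "'a \<Rightarrow> 'a \<Rightarrow> 'a" (infixl \<open>\<odot>\<close> 70)
    and Basis :: "'a set"
begin

lemma mult_zero_left [simp]: "0 \<odot> x = 0"
  using mult_add_left[of 0 0 x] by simp

lemma mult_zero_right [simp]: "x \<odot> 0 = 0"
  using mult_add_right[of x 0 0] by simp

lemma mult_minus_left: "(- x) \<odot> y = - (x \<odot> y)"
  using mult_add_left[of x "- x" y] by (simp add: eq_neg_iff_add_eq_0 add.commute)

lemma mult_minus_right: "x \<odot> (- y) = - (x \<odot> y)"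
  using mult_add_right[of x y "- y"] by (simp add: eq_neg_iff_add_eq_0 add.commute)

lemma mult_diff_left: "(x - y) \<odot> z = x \<odot> z - y \<odot> z"
  using mult_add_left[of x "- y" z] by (simp add: mult_minus_left)

lemma mult_diff_right: "x \<odot> (y - z) = x \<odot> y - x \<odot> z"
  using mult_add_right[of x y "- z"] by (simp add: mult_minus_right)

lemma left_symmetric':
  "x \<odot> (y \<odot> z) = (x \<odot> y) \<odot> z - (y \<odot> x) \<odot> z + y \<odot> (x \<odot> z)"
  using left_symmetric[of x y z] by (simp add: associator_def algebra_simps)

text \<open>The identity is among the generators so that \<open>R_x - 1\<close> and polynomials with
  a constant term belong to the algebra.\<close>

inductive_set right_ops :: "('a \<Rightarrow> 'a) set" where
  ident: "(\<lambda>v. v) \<in> right_ops"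
| right_mult: "(\<lambda>v. v \<odot> a) \<in> right_ops"
| sum: "S \<in> right_ops \<Longrightarrow> T \<in> right_ops \<Longrightarrow> (\<lambda>v. S v + T v) \<in> right_ops"
| scale: "T \<in> right_ops \<Longrightarrow> (\<lambda>v. c *s T v) \<in> right_ops"
| comp: "S \<in> right_ops \<Longrightarrow> T \<in> right_ops \<Longrightarrow> (\<lambda>v. S (T v)) \<in> right_ops"

lemma right_ops_diff:
  assumes "S \<in> right_ops" "T \<in> right_ops"
  shows "(\<lambda>v. S v - T v) \<in> right_ops"
  using right_ops.sum[OF assms(1) right_ops.scale[OF assms(2), of "- 1"]] by simp

lemma right_ops_zero: "(\<lambda>v. 0) \<in> right_ops"
  using right_ops.scale[OF right_ops.ident, of 0] by simp

lemma right_ops_add: "T \<in> right_ops \<Longrightarrow> T (u + v) = T u + T v"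
  by (induction arbitrary: u v rule: right_ops.induct)
    (simp_all add: mult_add_left scale_right_distrib add.assoc add.left_commute)

lemma right_ops_scale: "T \<in> right_ops \<Longrightarrow> T (c *s v) = c *s T v"
  by (induction arbitrary: v rule: right_ops.induct)
    (simp_all add: mult_scale_left scale_right_distrib mult.commute)

lemma right_ops_0: "T \<in> right_ops \<Longrightarrow> T 0 = 0"
  using right_ops_add[of T 0 0] by simp

lemma right_ops_minus: "T \<in> right_ops \<Longrightarrow> T (u - v) = T u - T v"
  using right_ops_add[of T "u - v" v] by (simp add: algebra_simps)

lemma right_ops_commute_right_mult: "T \<in> right_ops \<Longrightarrow> T (v \<odot> a) = T v \<odot> a"
  by (induction arbitrary: v rule: right_ops.induct)
    (simp_all add: mult_add_left mult_scale_left right_commutative)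

lemma right_ops_commute:
  assumes "S \<in> right_ops" "T \<in> right_ops"
  shows "S (T v) = T (S v)"
  using assms
  by (induction arbitrary: v rule: right_ops.induct)
    (simp_all add: right_ops_commute_right_mult right_ops_add right_ops_scale)

text \<open>The commutator of \<open>T\<close> with left multiplication by \<open>y\<close>.\<close>

definition bracket :: "'a \<Rightarrow> ('a \<Rightarrow> 'a) \<Rightarrow> 'a \<Rightarrow> 'a" where
  "bracket y T v = T (y \<odot> v) - y \<odot> T v"

lemma right_ops_mult_left: "T (y \<odot> v) = y \<odot> T v + bracket y T v"
  by (simp add: bracket_def)

lemma bracket_right_mult: "bracket y (\<lambda>v. v \<odot> z) v = (v \<odot> y) \<odot> z - v \<odot> (y \<odot> z)"
  using left_symmetric[of y v z] by (simp add: bracket_def associator_def)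

text \<open>Left symmetry settles right multiplications, the Leibniz rule compositions.\<close>

lemma bracket_in_right_ops: "T \<in> right_ops \<Longrightarrow> bracket y T \<in> right_ops"
proof (induction rule: right_ops.induct)
  case ident
  then show ?case using right_ops_zero by (simp add: bracket_def[abs_def])
next
  case (right_mult a)
  have "(\<lambda>v. (v \<odot> y) \<odot> a - v \<odot> (y \<odot> a)) \<in> right_ops"
    by (intro right_ops_diff right_ops.comp[OF right_ops.right_mult right_ops.right_mult]
        right_ops.right_mult)
  then show ?case by (simp add: bracket_right_mult[abs_def])
next
  case (sum S T)
  have "bracket y (\<lambda>v. S v + T v) = (\<lambda>v. bracket y S v + bracket y T v)"
    by (simp add: bracket_def mult_add_right fun_eq_iff)
  with sum show ?case by (simp add: right_ops.sum)
next
  case (scale T c)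
  have "bracket y (\<lambda>v. c *s T v) = (\<lambda>v. c *s bracket y T v)"
    by (simp add: bracket_def mult_scale_right scale_right_diff_distrib fun_eq_iff)
  with scale show ?case by (simp add: right_ops.scale)
next
  case (comp S T)
  have "bracket y (\<lambda>v. S (T v)) = (\<lambda>v. S (bracket y T v) + bracket y S (T v))"
    using comp by (simp add: bracket_def right_ops_minus fun_eq_iff)
  with comp show ?case by (simp add: right_ops.sum right_ops.comp)
qed

section \<open>Right ideals and maximal right subideals\<close>

definition right_ideal :: "'a set \<Rightarrow> bool" where
  "right_ideal M \<longleftrightarrow> subspace M \<and> (\<forall>m\<in>M. \<forall>a. m \<odot> a \<in> M)"

definition two_sided_ideal :: "'a set \<Rightarrow> bool" where
  "two_sided_ideal M \<longleftrightarrow> right_ideal M \<and> (\<forall>m\<in>M. \<forall>a. a \<odot> m \<in> M)"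

lemma right_ideal_right_ops:
  assumes "right_ideal M" "T \<in> right_ops" "v \<in> M"
  shows "T v \<in> M"
  using assms(2,3)
  by (induction arbitrary: v rule: right_ops.induct)
    (use assms(1) in \<open>auto simp: right_ideal_def subspace_def\<close>)

definition maximal_right_ideal :: "'a set \<Rightarrow> 'a set \<Rightarrow> bool" where
  "maximal_right_ideal M B \<longleftrightarrow> right_ideal B \<and> right_ideal M \<and> M \<subset> B \<and>
     (\<forall>W. right_ideal W \<longrightarrow> M \<subseteq> W \<longrightarrow> W \<subseteq> B \<longrightarrow> W = M \<or> W = B)"

lemma ex_maximal_right_ideal:
  assumes "right_ideal B" "B \<noteq> {0}"
  obtains M where "maximal_right_ideal M B"
proof -
  let ?P = "\<lambda>M. right_ideal M \<and> M \<subset> B"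
  have "?P {0}"
    using assms by (auto simp: right_ideal_def subspace_0)
  moreover have "\<forall>M. ?P M \<longrightarrow> dim M < Suc (dim B)"
    by (auto intro!: le_imp_less_Suc dim_subset)
  ultimately obtain M where M: "?P M" "\<And>W. ?P W \<Longrightarrow> dim W \<le> dim M"
    using ex_has_greatest_nat[of ?P "{0}" dim "Suc (dim B)"] by blast
  have "W = M" if "right_ideal W" "M \<subseteq> W" "W \<subseteq> B" "W \<noteq> B" for W
    using subspace_dim_equal[of M W] M(2)[of W] M(1) that by (auto simp: right_ideal_def)
  with M(1) assms have "maximal_right_ideal M B"
    unfolding maximal_right_ideal_def by blast
  then show ?thesis by (rule that)
qed

context
  fixes M B
  assumes max: "maximal_right_ideal M B"
begin

lemma right_ideal_transporter:
  assumes "S \<in> right_ops"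
  shows "right_ideal {v \<in> B. S v \<in> M}"
  using max assms
  by (auto simp: maximal_right_ideal_def right_ideal_def subspace_def right_ops_0 right_ops_add
      right_ops_scale right_ops_commute_right_mult)

text \<open>A Schur-type dichotomy: \<open>S\<close> commutes with right multiplications, so the set
  is a right ideal between \<open>M\<close> and \<open>B\<close>.\<close>

lemma transporter_cases:
  assumes "S \<in> right_ops"
  shows "{v \<in> B. S v \<in> M} = M \<or> {v \<in> B. S v \<in> M} = B"
proof -
  have "M \<subseteq> {v \<in> B. S v \<in> M}"
    using max right_ideal_right_ops[OF _ assms] by (auto simp: maximal_right_ideal_def)
  then show ?thesis
    using max right_ideal_transporter[OF assms] by (simp add: maximal_right_ideal_def)
qed

lemma transporter_all:
  assumes "S \<in> right_ops" "v \<in> B" "v \<notin> M" "S v \<in> M" "w \<in> B"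
  shows "S w \<in> M"
  using transporter_cases[OF assms(1)] assms by blast

text \<open>By \<open>hom\<close>, the set \<open>v B + M\<close> is a right ideal. It contains
  \<open>v \<odot> x\<close>, which is outside \<open>M\<close>, so it is all of \<open>B\<close>
  and contains \<open>v\<close>.\<close>

lemma ex_modular_unit:
  assumes v: "v \<in> B" "v \<notin> M" and x: "v \<odot> x \<notin> M" and BB: "two_sided_ideal B"
    and hom: "\<And>b c w. w \<in> B \<Longrightarrow> (w \<odot> b) \<odot> c - w \<odot> (b \<odot> c) \<in> M"
    and xB: "x \<in> B"
  obtains e where "e \<in> B" "v \<odot> e - v \<in> M"
proof -
  let ?W = "{v \<odot> b + m | b m. b \<in> B \<and> m \<in> M}"
  have B: "subspace B" "\<And>b c. b \<in> B \<Longrightarrow> b \<odot> c \<in> B" "\<And>b c. b \<in> B \<Longrightarrow> c \<odot> b \<in> B"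
    and M: "subspace M" "\<And>b c. b \<in> M \<Longrightarrow> b \<odot> c \<in> M" "M \<subseteq> B"
    using BB max by (auto simp: two_sided_ideal_def right_ideal_def maximal_right_ideal_def)
  have "right_ideal ?W"
    unfolding right_ideal_def
  proof (intro conjI ballI allI subspaceI)
    show "0 \<in> ?W"
      using B(1) M(1) by (force intro: exI[of _ 0] simp: subspace_0)
  next
    fix s t assume "s \<in> ?W" "t \<in> ?W"
    then obtain b m c n where "s = v \<odot> b + m" "t = v \<odot> c + n" "b \<in> B" "m \<in> M" "c \<in> B" "n \<in> M"
      by blast
    then have "s + t = v \<odot> (b + c) + (m + n)" "b + c \<in> B" "m + n \<in> M"
      using B(1) M(1) by (simp_all add: mult_add_right subspace_add algebra_simps)
    then show "s + t \<in> ?W" by blast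
  next
    fix c s assume "s \<in> ?W"
    then obtain b m where "s = v \<odot> b + m" "b \<in> B" "m \<in> M"
      by blast
    then have "c *s s = v \<odot> (c *s b) + c *s m" "c *s b \<in> B" "c *s m \<in> M"
      using B(1) M(1) by (simp_all add: mult_scale_right subspace_scale scale_right_distrib)
    then show "c *s s \<in> ?W" by blast
  next
    fix s a assume "s \<in> ?W"
    then obtain b m where s: "s = v \<odot> b + m" "b \<in> B" "m \<in> M"
      by blast
    then have "s \<odot> a = v \<odot> (b \<odot> a) + (((v \<odot> b) \<odot> a - v \<odot> (b \<odot> a)) + m \<odot> a)"
      by (simp add: mult_add_left)
    moreover have "((v \<odot> b) \<odot> a - v \<odot> (b \<odot> a)) + m \<odot> a \<in> M"
      using hom[OF v(1)] M s by (simp add: subspace_add)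
    ultimately show "s \<odot> a \<in> ?W"
      using B(2)[OF s(2)] by blast
  qed
  moreover have "M \<subseteq> ?W"
  proof
    fix m assume "m \<in> M"
    then have "m = v \<odot> 0 + m" "0 \<in> B" using B(1) by (simp_all add: subspace_0)
    with \<open>m \<in> M\<close> show "m \<in> ?W" by blast
  qed
  moreover have "?W \<subseteq> B"
    using B M by (auto intro: subspace_add)
  moreover have "v \<odot> x \<in> ?W"
  proof -
    have "v \<odot> x = v \<odot> x + 0" "0 \<in> M" using M(1) by (simp_all add: subspace_0)
    with xB show ?thesis by blast
  qed
  with x have "?W \<noteq> M" by blast
  ultimately have "?W = B"
    using max unfolding maximal_right_ideal_def by blast
  with v obtain b m where "v = v \<odot> b + m" "b \<in> B" "m \<in> M" by blast
  moreover from this have "v \<odot> b - v = - m" by (simp add: algebra_simps)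
  ultimately show ?thesis
    using that[of b] M(1) by (simp add: subspace_neg)
qed

end

section \<open>Horner evaluation of polynomials at an operator\<close>

definition op_poly :: "'f poly \<Rightarrow> ('a \<Rightarrow> 'a) \<Rightarrow> 'a \<Rightarrow> 'a" where
  "op_poly p T = fold_coeffs (\<lambda>a S v. a *s v + T (S v)) p (\<lambda>v. 0)"

context
  fixes T assumes T: "T \<in> right_ops"
begin

lemma op_poly_0 [simp]: "op_poly 0 T v = 0"
  by (simp add: op_poly_def)

lemma op_poly_pCons [simp]: "op_poly (pCons a p) T v = a *s v + T (op_poly p T v)"
  by (cases "p = 0 \<and> a = 0") (auto simp: op_poly_def right_ops_0[OF T])

lemma op_poly_in_right_ops: "op_poly p T \<in> right_ops"
proof (induction p)
  case 0
  show ?case using right_ops_zero by (simp add: op_poly_def)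
next
  case (pCons a p)
  have "op_poly (pCons a p) T = (\<lambda>v. a *s v + T (op_poly p T v))"
    by (simp add: fun_eq_iff)
  with pCons T show ?case
    by (simp add: right_ops.sum right_ops.scale right_ops.ident right_ops.comp)
qed

lemma op_poly_add: "op_poly (p + q) T v = op_poly p T v + op_poly q T v"
  by (induction p q rule: poly_induct2)
    (simp_all add: right_ops_add[OF T] scale_left_distrib algebra_simps)

lemma op_poly_smult: "op_poly (smult c p) T v = c *s op_poly p T v"
  by (induction p) (simp_all add: right_ops_scale[OF T] scale_right_distrib)

lemma op_poly_mult: "op_poly (p * q) T v = op_poly p T (op_poly q T v)"
  by (induction p) (simp_all add: op_poly_add op_poly_smult)

lemma op_poly_sum: "op_poly (sum p I) T v = (\<Sum>i\<in>I. op_poly (p i) T v)"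
  by (induction I rule: infinite_finite_induct) (simp_all add: op_poly_add)

text \<open>The derivation \<open>[., L_y]\<close> takes \<open>p(T)\<close> to
  \<open>p'(T) [T, L_y]\<close>, because \<open>T\<close> commutes with its own bracket.\<close>

lemma op_poly_mult_left:
  "op_poly p T (y \<odot> v) = y \<odot> op_poly p T v + op_poly (pderiv p) T (bracket y T v)"
proof (induction p)
  case (pCons a p)
  have "bracket y T (op_poly p T v) = op_poly p T (bracket y T v)"
    by (rule right_ops_commute[OF bracket_in_right_ops[OF T] op_poly_in_right_ops])
  with pCons show ?case
    by (simp add: pderiv_pCons op_poly_add right_ops_add[OF T] mult_add_right mult_scale_right
        right_ops_mult_left[of T] algebra_simps)
qed simp

lemma ex_annihilating_poly_vector: "\<exists>p. p \<noteq> 0 \<and> op_poly p T v = 0"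
proof (rule ccontr)
  assume *: "\<nexists>p. p \<noteq> 0 \<and> op_poly p T v = 0"
  let ?b = "\<lambda>i::nat. op_poly (monom 1 i) T v"
  have inj: "inj ?b"
  proof (rule injI)
    fix i j assume "?b i = ?b j"
    then have "op_poly (monom 1 i + smult (- 1) (monom 1 j)) T v = 0"
      unfolding op_poly_add op_poly_smult by simp
    with * have "monom 1 i + smult (- 1) (monom 1 j) = (0 :: 'f poly)" by blast
    then have "monom (1::'f) i = monom 1 j" by simp
    then show "i = j" by (metis degree_monom_eq one_neq_zero)
  qed
  \<comment> \<open>These are \<open>dimension + 1\<close> vectors, one too many to be
    independent.\<close>
  let ?S = "?b ` {..dimension}"
  have "independent ?S"
  proof (rule independent_if_scalars_zero)
    fix u w assume u: "(\<Sum>w\<in>?S. u w *s w) = 0" and w: "w \<in> ?S"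
    then obtain i where i: "i \<le> dimension" "w = ?b i" by blast
    let ?p = "\<Sum>i\<le>dimension. smult (u (?b i)) (monom 1 i)"
    have "op_poly ?p T v = (\<Sum>w\<in>?S. u w *s w)"
      by (simp add: op_poly_sum op_poly_smult sum.reindex[OF inj_on_subset[OF inj]])
    with u * have "?p = 0" by auto
    then have "coeff ?p i = 0" by simp
    with i show "u w = 0" by (simp add: coeff_sum if_distrib cong: if_cong)
  qed simp
  from independent_card_le_dim[OF subset_UNIV this]
  show False
    by (simp add: card_image[OF inj_on_subset[OF inj]] dimension_def)
qed

text \<open>The product of annihilating polynomials of the basis vectors kills \<open>Basis\<close>,
  hence everything by linearity.\<close>

lemma ex_annihilating_poly: "\<exists>p. p \<noteq> 0 \<and> (\<forall>v. op_poly p T v = 0)"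
proof -
  have "\<exists>p. p \<noteq> 0 \<and> (\<forall>v\<in>S. op_poly p T v = 0)" if "finite S" for S
    using that
  proof induction
    case empty
    show ?case by (auto intro: exI[of _ 1])
  next
    case (insert b S)
    then obtain p where p: "p \<noteq> 0" "\<And>v. v \<in> S \<Longrightarrow> op_poly p T v = 0" by blast
    obtain q where q: "q \<noteq> 0" "op_poly q T b = 0"
      using ex_annihilating_poly_vector by blast
    have "op_poly (q * p) T v = 0" if "v \<in> insert b S" for v
      using that p q op_poly_mult[of p q v] op_poly_mult[of q p v]
      by (auto simp: mult.commute right_ops_0[OF op_poly_in_right_ops])
    with p q show ?case by (intro exI[of _ "q * p"]) simp
  qed
  from this[OF finite_Basis] obtain p
    where p: "p \<noteq> 0" "\<And>v. v \<in> Basis \<Longrightarrow> op_poly p T v = 0" by blast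
  have "op_poly p T v = 0" for v
  proof -
    have "v \<in> span Basis" by (simp add: span_Basis)
    then show ?thesis
      using op_poly_in_right_ops[of p]
      by (induction rule: span_induct_alt) (simp_all add: p right_ops_0 right_ops_add right_ops_scale)
  qed
  with p show ?thesis by blast
qed

end

section \<open>Operators modulo a maximal right ideal\<close>

context
  fixes M B
  assumes max: "maximal_right_ideal M B"
begin

text \<open>Primeness of the ideal of operators mapping \<open>B\<close> into \<open>M\<close>: some
  \<open>T w\<close> lies in \<open>B\<close> outside \<open>M\<close> and can be used to test
  \<open>S\<close>.\<close>

lemma not_into_maximal_comp:
  assumes "S \<in> right_ops" "T \<in> right_ops"
    and "\<exists>w\<in>B. S w \<notin> M" "\<exists>w\<in>B. T w \<notin> M"
  shows "\<exists>w\<in>B. S (T w) \<notin> M"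
proof -
  obtain w where w: "w \<in> B" "T w \<notin> M" using assms by blast
  then have "T w \<in> B"
    using max assms(2) by (auto simp: maximal_right_ideal_def intro: right_ideal_right_ops)
  with w show ?thesis
    using transporter_all[OF max assms(1)] assms(3) by blast
qed

text \<open>
  The usual argument that a derivation kills separable algebraic elements, localised at the prime
  ideal: among all \<open>p\<close> with \<open>p(T) S = 0\<close> for some \<open>S\<close> outside it take one of least degree. Then
  \<open>p'(T) \<cdot> [T, L\<^sub>y] \<cdot> S\<^sup>2 = 0\<close>, so \<open>[T, L\<^sub>y]\<close> cannot be outside it as well.
\<close>
lemma bracket_into_maximal:
  assumes char: "CHAR('f) = 0" and T: "T \<in> right_ops" and w: "w \<in> B"
  shows "bracket y T w \<in> M"
proof (rule ccontr)
  assume D: "bracket y T w \<notin> M"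
  let ?D = "bracket y T"
  have D_op: "?D \<in> right_ops" by (rule bracket_in_right_ops[OF T])
  define P where "P p \<longleftrightarrow> p \<noteq> 0 \<and>
    (\<exists>S\<in>right_ops. (\<exists>w\<in>B. S w \<notin> M) \<and> (\<forall>v. op_poly p T (S v) = 0))" for p
  obtain p0 where p0: "p0 \<noteq> 0" "\<And>v. op_poly p0 T v = 0"
    using ex_annihilating_poly[OF T] by blast
  have "\<exists>w\<in>B. w \<notin> M"
    using max by (auto simp: maximal_right_ideal_def)
  then have "P p0"
    unfolding P_def using p0 by (intro conjI bexI[OF _ right_ops.ident]) simp_all
  then obtain p where "P p" and min: "\<And>q. P q \<Longrightarrow> degree p \<le> degree q"
    using ex_has_least_nat[of P p0 degree] by blast
  then obtain S where p: "p \<noteq> 0" and S: "S \<in> right_ops" "\<exists>w\<in>B. S w \<notin> M"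
    and 0: "\<And>v. op_poly p T (S v) = 0" unfolding P_def by blast
  have deg: "degree p > 0"
  proof (rule ccontr)
    assume "\<not> degree p > 0"
    then obtain a where "p = [:a:]" by (auto elim: degree_eq_zeroE)
    with p 0 have "S v = 0" for v by (simp add: T right_ops_0[OF T])
    with S(2) max show False
      by (simp add: maximal_right_ideal_def right_ideal_def subspace_0)
  qed
  have "op_poly (pderiv p) T (?D (S (S v))) = 0" for v
  proof -
    have "op_poly (pderiv p) T (?D (S (S v))) = op_poly p T (y \<odot> S (S v))"
      using op_poly_mult_left[OF T, of p y "S (S v)"] 0 by simp
    \<comment> \<open>The bracket of \<open>S\<close> commutes with \<open>S\<close>, so the second
      factor \<open>S\<close> makes both terms values of \<open>S\<close>, which \<open>p(T)\<close>
      kills.\<close>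
    also have "y \<odot> S (S v) = S (y \<odot> S v) - S (bracket y S v)"
      using right_ops_commute[OF S(1) bracket_in_right_ops[OF S(1)], of y v]
      by (simp add: right_ops_mult_left[of S])
    also have "op_poly p T \<dots> = 0"
      by (simp add: right_ops_minus[OF op_poly_in_right_ops[OF T]] 0)
    finally show ?thesis .
  qed
  moreover have "(\<lambda>v. ?D (S (S v))) \<in> right_ops"
    by (rule right_ops.comp[OF D_op right_ops.comp[OF S(1) S(1)]])
  moreover have "\<exists>w\<in>B. ?D (S (S w)) \<notin> M"
    using D w
    by (intro not_into_maximal_comp[OF D_op right_ops.comp[OF S(1) S(1)]]
        not_into_maximal_comp[OF S(1) S(1) S(2) S(2)]) blast
  \<comment> \<open>Characteristic \<open>0\<close> enters here, through the leading coefficient of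
    the derivative.\<close>
  moreover have "pderiv p \<noteq> 0"
  proof -
    have "coeff (pderiv p) (degree p - 1) = of_nat (degree p) * lead_coeff p"
      using deg by (simp add: coeff_pderiv del: of_nat_Suc)
    moreover have "(of_nat (degree p) :: 'f) \<noteq> 0"
      using deg by (simp add: of_nat_eq_0_iff_char_dvd char)
    ultimately show ?thesis using p by auto
  qed
  ultimately have "P (pderiv p)"
    unfolding P_def by (intro conjI bexI[of _ "\<lambda>v. ?D (S (S v))"]) simp_all
  then have "degree p \<le> degree (pderiv p)" by (rule min)
  moreover have "degree (pderiv p) \<le> degree p - 1"
    by (rule degree_le) (auto simp: coeff_pderiv coeff_eq_0)
  ultimately show False using deg by simp
qed

text \<open>A polynomial of least degree killing \<open>T\<close> modulo \<open>M\<close> has a root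
  \<open>c\<close>. The cofactor \<open>q\<close> does not map \<open>B\<close> into
  \<open>M\<close>, so primeness forces \<open>T - c\<close> to do so.\<close>

lemma alg_closed_scalar_mod_maximal:
  assumes "alg_closed TYPE('f)" and T: "T \<in> right_ops"
  obtains c where "\<And>w. w \<in> B \<Longrightarrow> T w - c *s w \<in> M"
proof -
  have M: "subspace M"
    using max by (simp add: maximal_right_ideal_def right_ideal_def)
  define P where "P p \<longleftrightarrow> p \<noteq> 0 \<and> (\<forall>w\<in>B. op_poly p T w \<in> M)" for p
  obtain p0 where "p0 \<noteq> 0" "\<And>v. op_poly p0 T v = 0"
    using ex_annihilating_poly[OF T] by blast
  then have "P p0" using subspace_0[OF M] by (simp add: P_def)
  then obtain p where "P p" and min: "\<And>q. P q \<Longrightarrow> degree p \<le> degree q"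
    using ex_has_least_nat[of P p0 degree] by blast
  then have p: "p \<noteq> 0" "\<And>w. w \<in> B \<Longrightarrow> op_poly p T w \<in> M" by (auto simp: P_def)
  have "degree p > 0"
  proof (rule ccontr)
    assume "\<not> degree p > 0"
    then obtain a where a: "p = [:a:]" by (auto elim: degree_eq_zeroE)
    have "w \<in> M" if "w \<in> B" for w
      using subspace_scale[OF M, of "a *s w" "inverse a"] p(1) p(2)[OF that] a
      by (auto simp: T right_ops_0[OF T])
    with max show False by (auto simp: maximal_right_ideal_def)
  qed
  with assms(1) obtain c where "poly p c = 0"
    by (auto simp: alg_closed_def)
  then obtain q where q: "p = [:- c, 1:] * q"
    by (auto simp: poly_eq_0_iff_dvd)
  with p(1) have "q \<noteq> 0" by auto
  then have "degree p = Suc (degree q)"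
    unfolding q by (subst degree_mult_eq) auto
  with min[of q] \<open>q \<noteq> 0\<close> have "\<exists>w\<in>B. op_poly q T w \<notin> M" by (auto simp: P_def)
  moreover have "\<forall>w\<in>B. op_poly [:- c, 1:] T (op_poly q T w) \<in> M"
    using p by (simp add: q op_poly_mult[OF T] del: mult_pCons_left)
  ultimately have *: "op_poly [:- c, 1:] T w \<in> M" if "w \<in> B" for w
    using not_into_maximal_comp[OF op_poly_in_right_ops[OF T] op_poly_in_right_ops[OF T]] that
    by blast
  show ?thesis
    using * by (intro that[of c]) (simp add: T right_ops_0[OF T])
qed

lemma quasiregular_product_in_maximal:
  assumes char: "CHAR('f) = 0 \<or> alg_closed TYPE('f)"
    and lq: left_quasiregular and ideal: "two_sided_ideal B"
    and b: "b \<in> B" and x: "x \<in> B"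
  shows "b \<odot> x \<in> M"
proof (rule ccontr)
  assume bx: "b \<odot> x \<notin> M"
  have B: "subspace B" "\<And>u a. u \<in> B \<Longrightarrow> u \<odot> a \<in> B" "\<And>u a. u \<in> B \<Longrightarrow> a \<odot> u \<in> B"
    and M: "right_ideal M" "subspace M" "\<And>u a. u \<in> M \<Longrightarrow> u \<odot> a \<in> M" "M \<subseteq> B"
    using ideal max by (auto simp: two_sided_ideal_def right_ideal_def maximal_right_ideal_def)
  have qr: "\<exists>y\<in>B. e + y = y \<odot> e" if e: "e \<in> B" for e
  proof -
    obtain y where y: "e + y = y \<odot> e"
      using lq by (auto simp: left_quasiregular_def left_quasiregular_elem_def)
    then have "y = y \<odot> e - e" by (metis add_diff_cancel_left')
    with B e have "y \<in> B" by (metis subspace_diff)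
    with y show ?thesis by blast
  qed
  have b_M: "b \<notin> M" using bx M(3) by blast
  show False
    using char
  proof
    assume "alg_closed TYPE('f)"
    have "\<exists>c. \<forall>w\<in>B. w \<odot> z - c *s w \<in> M" for z
      using alg_closed_scalar_mod_maximal[OF \<open>alg_closed _\<close> right_ops.right_mult] by metis
    then obtain \<mu> where \<mu>: "\<And>z w. w \<in> B \<Longrightarrow> w \<odot> z - \<mu> z *s w \<in> M" by metis
    \<comment> \<open>Since \<open>b\<close> lies outside \<open>M\<close>, the value
      \<open>\<mu> z\<close> can be read off from \<open>b\<close> alone; this yields linearity of
      \<open>\<mu>\<close>.\<close>
    have scalar: "\<mu> z = c" if "b \<odot> z - c *s b \<in> M" for z c
    proof (rule ccontr)
      assume "\<mu> z \<noteq> c"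
      have "(\<mu> z - c) *s b \<in> M"
        using subspace_diff[OF M(2) that \<mu>[OF b, of z]] by (simp add: scale_left_diff_distrib)
      from subspace_scale[OF M(2) this, of "inverse (\<mu> z - c)"] \<open>\<mu> z \<noteq> c\<close> b_M
      show False by simp
    qed
    \<comment> \<open>Quasiregularity writes \<open>z\<close> as \<open>y \<odot> z - y\<close>, a
      value of \<open>R_z - \<mu> z\<close>.\<close>
    have one: "z \<in> M" if "z \<in> B" "\<mu> z = 1" for z
    proof -
      obtain y where y: "y \<in> B" "z + y = y \<odot> z" using qr[OF \<open>z \<in> B\<close>] by blast
      then have "z = y \<odot> z - 1 *s y" by (simp add: eq_diff_eq)
      with \<mu>[OF y(1), of z] that show ?thesis by simp
    qed
    have \<mu>_add: "\<mu> (y + z) = \<mu> y + \<mu> z" for y z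
      using subspace_add[OF M(2) \<mu>[OF b, of y] \<mu>[OF b, of z]]
      by (intro scalar) (simp add: mult_add_right scale_left_distrib algebra_simps)
    have \<mu>_scale: "\<mu> (c *s z) = c * \<mu> z" for c z
      using subspace_scale[OF M(2) \<mu>[OF b, of z], of c]
      by (intro scalar) (simp add: mult_scale_right scale_right_diff_distrib)
    have x0: "\<mu> x \<noteq> 0" using \<mu>[OF b, of x] bx by auto
    define e where "e = inverse (\<mu> x) *s x"
    have e: "e \<in> B" "\<mu> e = 1"
      using x x0 B(1) by (simp_all add: e_def \<mu>_scale subspace_scale)
    \<comment> \<open>Both \<open>z + e\<close> and \<open>e\<close> have \<open>\<mu>\<close>-value
      \<open>1\<close>.\<close>
    have zero: "z \<in> M" if "z \<in> B" "\<mu> z = 0" for z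
      using subspace_diff[OF M(2) one[of "z + e"] one[OF e]] that e B(1)
      by (simp add: \<mu>_add subspace_add)
    have "b - \<mu> b *s e \<in> M"
    proof (rule zero)
      have "b - \<mu> b *s e = b + (- \<mu> b) *s e" by simp
      then show "\<mu> (b - \<mu> b *s e) = 0"
        by (simp only: \<mu>_add \<mu>_scale e) simp
    qed (use b e B(1) in \<open>simp add: subspace_diff subspace_scale\<close>)
    from subspace_add[OF M(2) this subspace_scale[OF M(2) one[OF e], of "\<mu> b"]] b_M
    show False by simp
  next
    assume char0: "CHAR('f) = 0"
    have hom: "(w \<odot> y) \<odot> z - w \<odot> (y \<odot> z) \<in> M" if "w \<in> B" for y z w
      using bracket_into_maximal[OF char0 right_ops.right_mult that]
      by (simp add: bracket_right_mult)
    obtain e where e: "e \<in> B" "b \<odot> e - b \<in> M"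
      using ex_modular_unit[OF max b b_M bx ideal hom x] by blast
    obtain y where y: "e + y = y \<odot> e" using qr[OF e(1)] by blast
    \<comment> \<open>Modulo \<open>M\<close>, \<open>b \<odot> y\<close> equals
      \<open>(b \<odot> e) \<odot> y = (b \<odot> y) \<odot> e\<close>, which is congruent to
      \<open>b \<odot> (y \<odot> e) = b \<odot> (e + y)\<close>. Hence \<open>b \<odot> e\<close>,
      and then \<open>b\<close>, lies in \<open>M\<close>.\<close>
    have "(b \<odot> e) \<odot> y - b \<odot> y \<in> M"
      using M(3)[OF e(2), of y] by (simp add: mult_diff_left)
    moreover have "(b \<odot> e) \<odot> y - b \<odot> (e + y) \<in> M"
      using hom[OF b, of y e] y by (simp add: right_commutative[of b e y])
    ultimately have "b \<odot> e \<in> M"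
      using subspace_diff[OF M(2)] by (fastforce simp: mult_add_right)
    from subspace_diff[OF M(2) this e(2)] b_M show False by simp
  qed
qed

end

section \<open>The derived series of a quasiregular algebra\<close>

lemma two_sided_ideal_derived: "two_sided_ideal (derived k)"
proof (induction k)
  case 0
  show ?case by (simp add: two_sided_ideal_def right_ideal_def)
next
  case (Suc k)
  let ?G = "{x \<odot> y | x y. x \<in> derived k \<and> y \<in> derived k}"
  have D: "\<And>m a. m \<in> derived k \<Longrightarrow> m \<odot> a \<in> derived k"
    "\<And>m a. m \<in> derived k \<Longrightarrow> a \<odot> m \<in> derived k"
    using Suc by (auto simp: two_sided_ideal_def right_ideal_def)
  have G: "x \<odot> y \<in> span ?G" if "x \<in> derived k" "y \<in> derived k" for x y
    using that by (blast intro: span_base)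
  have "m \<odot> a \<in> span ?G \<and> a \<odot> m \<in> span ?G" if "m \<in> span ?G" for m a
    using that
  proof (induction rule: span_induct_alt)
    case base
    show ?case by (simp add: span_zero)
  next
    case (step c m n)
    then obtain x y where xy: "m = x \<odot> y" "x \<in> derived k" "y \<in> derived k" by blast
    have "m \<odot> a \<in> span ?G"
      using xy D by (simp add: right_commutative[of x y a] G)
    \<comment> \<open>Left symmetry turns \<open>a \<odot> (x \<odot> y)\<close> into a combination
      of three products with both factors in \<open>derived k\<close>.\<close>
    moreover have "a \<odot> m \<in> span ?G"
      using xy D unfolding xy(1) left_symmetric'[of a x y]
      by (intro span_add span_diff G) auto
    ultimately show ?case
      using step by (simp add: mult_add_left mult_add_right mult_scale_left mult_scale_right
          span_add span_scale)
  qed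
  then show ?case by (simp add: two_sided_ideal_def right_ideal_def)
qed

lemma derived_decreasing:
  assumes "CHAR('f) = 0 \<or> alg_closed TYPE('f)" and left_quasiregular and "derived k \<noteq> {0}"
  shows "derived (Suc k) \<subset> derived k"
proof -
  have ideal: "two_sided_ideal (derived k)" by (rule two_sided_ideal_derived)
  then obtain M where M: "maximal_right_ideal M (derived k)"
    using ex_maximal_right_ideal assms(3) by (auto simp: two_sided_ideal_def)
  have "derived (Suc k) \<subseteq> M"
    unfolding derived.simps using quasiregular_product_in_maximal[OF M assms(1,2) ideal] M
    by (intro span_minimal) (auto simp: maximal_right_ideal_def right_ideal_def)
  with M show ?thesis by (auto simp: maximal_right_ideal_def)
qed

text \<open>While the series is nonzero, each step loses at least one dimension.\<close>

lemma quasiregular_imp_solvable: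
  assumes "CHAR('f) = 0 \<or> alg_closed TYPE('f)" and left_quasiregular
  shows solvable
proof (rule ccontr)
  assume "\<not> solvable"
  then have nz: "derived k \<noteq> {0}" for k by (auto simp: solvable_def)
  have sub: "subspace (derived k)" for k
    using two_sided_ideal_derived by (simp add: two_sided_ideal_def right_ideal_def)
  have dec: "dim (derived (Suc k)) < dim (derived k)" for k
    using derived_decreasing[OF assms nz, of k] dim_psubset[of "derived (Suc k)" "derived k"] sub
    by (metis span_eq_iff)
  have "dim (derived k) + k \<le> dimension" for k
  proof (induction k)
    case 0
    show ?case by (simp add: dimension_def)
  next
    case (Suc k)
    then show ?case using dec[of k] by linarith
  qed
  from this[of "Suc dimension"] show False by simp
qed

section \<open>Fitting decomposition of an operator\<close>

context
  fixes T assumes T: "T \<in> right_ops"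
begin

lemma funpow_in_right_ops: "T ^^ n \<in> right_ops"
proof (induction n)
  case 0
  show ?case using right_ops.ident by (simp add: id_def)
next
  case (Suc n)
  then show ?case using right_ops.comp[OF T] by (simp add: comp_def)
qed

text \<open>By the Leibniz rule \<open>E\<close> is \<open>(n + 1) [T, L_y]\<close>; what matters is
  that only one power of \<open>T\<close> is lost.\<close>

lemma bracket_funpow_Suc: "\<exists>E\<in>right_ops. \<forall>v. bracket y (T ^^ Suc n) v = (T ^^ n) (E v)"
proof (induction n)
  case 0
  show ?case using bracket_in_right_ops[OF T] by auto
next
  case (Suc n)
  then obtain E where E: "E \<in> right_ops" "\<And>v. bracket y (T ^^ Suc n) v = (T ^^ n) (E v)" by blast
  have "bracket y (T ^^ Suc (Suc n)) v = (T ^^ Suc n) (E v + bracket y T v)" for v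
  proof -
    have "bracket y (T ^^ Suc (Suc n)) v = T (bracket y (T ^^ Suc n) v) + bracket y T ((T ^^ Suc n) v)"
      by (simp add: bracket_def right_ops_minus[OF T])
    also have "bracket y T ((T ^^ Suc n) v) = (T ^^ Suc n) (bracket y T v)"
      by (rule right_ops_commute[OF bracket_in_right_ops[OF T] funpow_in_right_ops])
    finally show ?thesis
      by (simp only: E) (simp add: right_ops_add[OF funpow_in_right_ops] right_ops_add[OF T])
  qed
  then show ?case
    by (intro bexI[OF _ right_ops.sum[OF E(1) bracket_in_right_ops[OF T]]]) blast
qed

text \<open>Kernels of powers grow and ranges shrink, so both stabilise in finite dimension.\<close>

lemma fitting_exponent:
  obtains N where "\<And>n v. (T ^^ n) v = 0 \<Longrightarrow> (T ^^ N) v = 0"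
    and "\<And>n v. \<exists>w. (T ^^ N) v = (T ^^ n) w"
proof -
  note op = funpow_in_right_ops
  have ker: "subspace {v. (T ^^ n) v = 0}" for n
    by (rule subspaceI) (simp_all add: right_ops_0[OF op] right_ops_add[OF op] right_ops_scale[OF op])
  have ran: "subspace (range (T ^^ n))" for n
  proof (rule subspaceI)
    show "0 \<in> range (T ^^ n)"
      using right_ops_0[OF op, of n] by (metis rangeI)
    show "s + t \<in> range (T ^^ n)" if "s \<in> range (T ^^ n)" "t \<in> range (T ^^ n)" for s t
    proof -
      from that obtain v w where "s = (T ^^ n) v" "t = (T ^^ n) w" by blast
      then have "s + t = (T ^^ n) (v + w)" by (simp only: right_ops_add[OF op])
      then show ?thesis by blast
    qed
    show "c *s s \<in> range (T ^^ n)" if "s \<in> range (T ^^ n)" for c s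
    proof -
      from that obtain v where "s = (T ^^ n) v" by blast
      then have "c *s s = (T ^^ n) (c *s v)" by (simp only: right_ops_scale[OF op])
      then show ?thesis by blast
    qed
  qed
  have ker_mono: "{v. (T ^^ n) v = 0} \<subseteq> {v. (T ^^ (m + n)) v = 0}" for m n
    by (auto simp: funpow_add right_ops_0[OF op])
  have ran_mono: "range (T ^^ (n + m)) \<subseteq> range (T ^^ n)" for m n
    by (auto simp: funpow_add)
  obtain N1 where N1: "\<And>n. dim {v. (T ^^ n) v = 0} \<le> dim {v. (T ^^ N1) v = 0}"
    using ex_has_greatest_nat[of "\<lambda>_. True" 0 "\<lambda>n. dim {v. (T ^^ n) v = 0}" "Suc dimension"]
      dim_subset_UNIV by (auto simp: less_Suc_eq_le)
  obtain N2 where N2: "\<And>n. dim (range (T ^^ N2)) \<le> dim (range (T ^^ n))"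
    using ex_has_least_nat[of "\<lambda>_. True" 0 "\<lambda>n. dim (range (T ^^ n))"] by auto
  have K: "{v. (T ^^ N1) v = 0} = {v. (T ^^ (m + N1)) v = 0}" for m
    using subspace_dim_equal[OF ker ker ker_mono] N1 by blast
  have R: "range (T ^^ (N2 + m)) = range (T ^^ N2)" for m
    using subspace_dim_equal[OF ran ran ran_mono] N2 by blast
  show ?thesis
  \<comment> \<open>The sum is past both points of stabilisation.\<close>
  proof (rule that[of "N2 + N1"])
    fix n v assume "(T ^^ n) v = 0"
    then have "v \<in> {v. (T ^^ (N1 + n)) v = 0}" using ker_mono by blast
    then have "v \<in> {v. (T ^^ N1) v = 0}" using K[of n] by (simp add: add.commute)
    then show "(T ^^ (N2 + N1)) v = 0" using ker_mono by blast
  next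
    fix n v
    have "(T ^^ (N2 + N1)) v \<in> range (T ^^ (N2 + n))" using R[of N1] R[of n] by blast
    then obtain w where "(T ^^ (N2 + N1)) v = (T ^^ (n + N2)) w"
      by (auto simp: add.commute)
    then have "(T ^^ (N2 + N1)) v = (T ^^ n) ((T ^^ N2) w)"
      by (simp only: funpow_add comp_apply)
    then show "\<exists>w. (T ^^ (N2 + N1)) v = (T ^^ n) w" ..
  qed
qed

end

section \<open>From solvability to quasiregularity\<close>

lemma solvable_imp_quasiregular:
  assumes solvable
  shows left_quasiregular
  unfolding left_quasiregular_def left_quasiregular_elem_def
proof
  fix x
  define T where "T = (\<lambda>v. v \<odot> x - v)"
  have T: "T \<in> right_ops"
    unfolding T_def by (rule right_ops_diff[OF right_ops.right_mult right_ops.ident])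
  note op = funpow_in_right_ops[OF T]
  obtain N where ker: "\<And>n v. (T ^^ n) v = 0 \<Longrightarrow> (T ^^ N) v = 0"
    and ran: "\<And>n v. \<exists>w. (T ^^ N) v = (T ^^ n) w"
    by (rule fitting_exponent[OF T]) blast
  \<comment> \<open>Stability of the ranges allows \<open>T ^^ (N + N)\<close> here; subtracting
    \<open>(T ^^ N) w\<close> from \<open>x\<close> then leaves a vector in the kernel.\<close>
  obtain w where w: "(T ^^ N) x = (T ^^ N) ((T ^^ N) w)"
    using ran[of x "N + N"] by (auto simp: funpow_add)
  define i where "i = (T ^^ N) w"
  define u where "u = x - i"
  have u: "(T ^^ N) u = 0"
    by (simp add: u_def i_def w right_ops_minus[OF op])
  have ker_left: "(T ^^ Suc N) (y \<odot> v) = 0" if "(T ^^ N) v = 0" for v y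
  proof -
    obtain E where E: "E \<in> right_ops" "\<And>v. bracket y (T ^^ Suc N) v = (T ^^ N) (E v)"
      using bracket_funpow_Suc[OF T] by blast
    have "(T ^^ N) (E v) = 0"
      using that by (simp add: right_ops_commute[OF op E(1)] right_ops_0[OF E(1)])
    then show ?thesis
      using that by (simp add: right_ops_mult_left[of "T ^^ Suc N"] E right_ops_0[OF T] del: funpow.simps)
         (simp add: right_ops_0[OF T])
  qed
  \<comment> \<open>The extra power of \<open>T\<close> in \<open>i\<close> makes up for the one
    lost in the commutator.\<close>
  have ran_left: "\<exists>z. y \<odot> i = (T ^^ N) z" for y
  proof -
    obtain v where v: "i = (T ^^ Suc N) v" using ran i_def by blast
    obtain E where E: "E \<in> right_ops" "\<And>v. bracket y (T ^^ Suc N) v = (T ^^ N) (E v)"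
      using bracket_funpow_Suc[OF T] by blast
    have "y \<odot> i = (T ^^ Suc N) (y \<odot> v) - (T ^^ N) (E v)"
      by (simp add: right_ops_mult_left[of "T ^^ Suc N"] E v del: funpow.simps)
    also have "\<dots> = (T ^^ N) (T (y \<odot> v) - E v)"
      by (simp add: right_ops_minus[OF op] funpow_swap1)
    finally show ?thesis by blast
  qed
  \<comment> \<open>The product lies in both Fitting components, which meet only in zero.\<close>
  have ker_i: "v \<odot> i = 0" if v: "(T ^^ N) v = 0" for v
  proof -
    obtain z where z: "v \<odot> i = (T ^^ N) z" using ran_left by blast
    have "(T ^^ N) (v \<odot> i) = 0"
      using v by (simp add: right_ops_commute_right_mult[OF op])
    then have "(T ^^ (N + N)) z = 0" by (simp add: z funpow_add)
    then show ?thesis using ker z by simp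
  qed
  \<comment> \<open>Nested induction: as \<open>v \<odot> x = v \<odot> u\<close>, one has
    \<open>v = v \<odot> u - T v\<close>, where the product is covered by the induction on
    \<open>k\<close> and \<open>T v\<close> is killed by a smaller power.\<close>
  have step: "v \<in> derived k" if "(T ^^ n) v = 0" for n v k
    using that
  proof (induction k arbitrary: n v)
    case 0
    show ?case by simp
  next
    case (Suc k)
    note in_derived = Suc.IH
    show ?case
      using Suc.prems
    proof (induction n arbitrary: v)
      case 0
      then show ?case by (simp add: span_zero)
    next
      case (Suc n)
      have "v \<odot> u \<in> derived (Suc k)"
        using in_derived[OF Suc.prems] in_derived[OF u] by (auto intro: span_base)
      moreover have "T v \<in> derived (Suc k)"
        by (rule Suc.IH) (use Suc.prems in \<open>simp add: funpow_Suc_right del: funpow.simps\<close>)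
      ultimately have "v \<odot> u - T v \<in> derived (Suc k)"
        unfolding derived.simps by (rule span_diff)
      moreover have "v \<odot> u - T v = v"
        using ker_i[OF ker[OF Suc.prems]] by (simp add: T_def u_def mult_diff_right)
      ultimately show ?case by (simp only:)
    qed
  qed
  obtain k where "derived k = {0}" using assms by (auto simp: solvable_def)
  with step[OF u] have "u = 0" by blast
  then have "x = i" by (simp add: u_def)
  moreover obtain y where "i = (T ^^ 1) y" using ran i_def by blast
  ultimately have "x = y \<odot> x - y" by (simp add: T_def)
  then show "\<exists>y. x + y = y \<odot> x" by (metis diff_add_cancel)
qed

end

theorem theorem4:
  fixes scale :: "'f::field \<Rightarrow> 'a::ab_group_add \<Rightarrow> 'a"
    and mult :: "'a \<Rightarrow> 'a \<Rightarrow> 'a"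
    and Basis :: "'a set"
  assumes "CHAR('f) = 0 \<or> (CHAR('f) > 2 \<and> alg_closed TYPE('f))"
    and "novikov_algebra scale mult"
    and "finite_dimensional_vector_space scale Basis"
  shows "nonassoc_algebra.left_quasiregular mult \<longleftrightarrow> nonassoc_algebra.solvable scale mult"
proof -
  interpret fd_novikov_algebra scale mult Basis
    using assms by (simp add: fd_novikov_algebra_def)
  show ?thesis
    using quasiregular_imp_solvable solvable_imp_quasiregular assms(1) by blast
qed

end
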